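(* Let $n\ge 1$, let $K$ be a field of characteristic zero, and let $\lambda_1,\ldots,\lambda_n\in K$ satisfy $\lambda_i\neq 0$ for all $i$ and $\lambda_i^2\neq\lambda_j^2$ for all $i\neq j$. Let $P(x_1,\ldots,x_n)\in K[x_1,\ldots,x_n]$ be a symmetric polynomial of degree not greater than $\frac{n(n+1)}{2}$. Then $$\sum_{I\subseteq [n]}\frac{P(\lambda_I)}{\prod_{1\le i<j\le n}(\lambda_{i,I}+\lambda_{j,I})\prod_{i=1}^n\lambda_{i,I}}=\frac{2^n c(n)}{n!},$$ where $c(n)$ is the coefficient of $x_1^{2n-1}\cdots x_n^{2n-1}$ in the polynomial $$P(x_1,\ldots,x_n)\prod_{i\neq j}(x_i-x_j)\prod_{i<j}(x_i+x_j).$$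
   Context: $[n]=\{1,2,\ldots,n\}$. For $I\subseteq[n]$ and $i\in[n]$, put $\lambda_{i,I}=\lambda_i$ if $i\in I$ and $\lambda_{i,I}=-\lambda_i$ if $i\notin I$, and $\lambda_I=(\lambda_{1,I},\ldots,\lambda_{n,I})$. The product $\prod_{i\neq j}$ is over all ordered pairs $(i,j)\in[n]^2$ with $i\neq j$; the product $\prod_{i<j}$ is over pairs $1\le i<j\le n$. A polynomial is symmetric if it is invariant under all permutations of its variables. *)

theory Defs
  imports Complex_Main "HOL-Library.Poly_Mapping" "HOL-Combinatorics.Permutations"
begin

text \<open>Polynomials in variables \<open>x\<^sub>i\<close> (\<open>i :: nat\<close>): finitely supported maps from monomials
  (finitely supported exponent vectors) to coefficients. The ring operations are those of
  \<^theory>\<open>HOL-Library.Poly_Mapping\<close>, and the coefficient of the monomial \<open>m\<close> in \<open>P\<close> is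
  \<open>Poly_Mapping.lookup P m\<close>. The ring \<open>K[x\<^sub>1,\<dots>,x\<^sub>n]\<close> consists of those \<open>P\<close> with
  \<open>mp_vars P \<subseteq> {1..n}\<close>.\<close>

type_synonym 'a mpoly = "(nat \<Rightarrow>\<^sub>0 nat) \<Rightarrow>\<^sub>0 'a"

definition mp_var :: "nat \<Rightarrow> 'a::comm_ring_1 mpoly" where
  "mp_var i = Poly_Mapping.single (Poly_Mapping.single i 1) 1"

definition mp_const :: "'a::comm_ring_1 \<Rightarrow> 'a mpoly" where
  "mp_const c = Poly_Mapping.single 0 c"

definition mp_vars :: "'a::comm_ring_1 mpoly \<Rightarrow> nat set" where
  "mp_vars P = (\<Union>m\<in>Poly_Mapping.keys P. Poly_Mapping.keys m)"

text \<open>Total degree; the zero polynomial gets degree 0, which is harmless for upper bounds.\<close>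

definition mp_degree :: "'a::comm_ring_1 mpoly \<Rightarrow> nat" where
  "mp_degree P = Max (insert 0
     ((\<lambda>m. \<Sum>i\<in>Poly_Mapping.keys m. Poly_Mapping.lookup m i) ` Poly_Mapping.keys P))"

definition mp_eval :: "(nat \<Rightarrow> 'a::comm_ring_1) \<Rightarrow> 'a mpoly \<Rightarrow> 'a" where
  "mp_eval a P = (\<Sum>m\<in>Poly_Mapping.keys P.
     Poly_Mapping.lookup P m * (\<Prod>i\<in>Poly_Mapping.keys m. a i ^ Poly_Mapping.lookup m i))"

definition mp_subst :: "(nat \<Rightarrow> 'a::comm_ring_1 mpoly) \<Rightarrow> 'a mpoly \<Rightarrow> 'a mpoly" where
  "mp_subst q P = (\<Sum>m\<in>Poly_Mapping.keys P.
     mp_const (Poly_Mapping.lookup P m) *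
     (\<Prod>i\<in>Poly_Mapping.keys m. q i ^ Poly_Mapping.lookup m i))"

definition mp_symmetric :: "nat \<Rightarrow> 'a::comm_ring_1 mpoly \<Rightarrow> bool" where
  "mp_symmetric n P \<longleftrightarrow>
     (\<forall>\<pi>. \<pi> permutes {1..n} \<longrightarrow> mp_subst (\<lambda>i. mp_var (\<pi> i)) P = P)"

definition signed :: "(nat \<Rightarrow> 'a::comm_ring_1) \<Rightarrow> nat set \<Rightarrow> nat \<Rightarrow> 'a" where
  "signed l I i = (if i \<in> I then l i else - l i)"

end

theory Submission
  imports Defs "HOL-Computational_Algebra.Polynomial" "HOL-Library.FuncSet"
begin

text \<open>On the grid \<open>A\<^sup>n\<close> with \<open>A = {\<plusminus>\<lambda>\<^sub>1, \<dots>, \<plusminus>\<lambda>\<^sub>n}\<close>, multivariate Lagrange interpolation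
  writes the coefficient of \<open>x\<^sub>1\<^sup>d \<cdots> x\<^sub>n\<^sup>d\<close>, \<open>d = 2n - 1\<close>, in a polynomial \<open>F\<close> of degree at most
  \<open>n d\<close> as the sum of \<open>F(a) / \<Prod>\<^sub>i \<phi>'(a\<^sub>i)\<close> over grid points \<open>a\<close>, where \<open>\<phi>(x) = \<Prod>\<^sub>i (x\<^sup>2 - \<lambda>\<^sub>i\<^sup>2)\<close>.
  For \<open>F = P \<Prod>\<^sub>i\<^sub>\<noteq>\<^sub>j (x\<^sub>i - x\<^sub>j) \<Prod>\<^sub>i\<^sub><\<^sub>j (x\<^sub>i + x\<^sub>j)\<close> the degree bound holds, only the permutations of the
  points \<open>\<lambda>\<^sub>I\<close> survive, and \<open>F\<close> is symmetric, so each \<open>I\<close> contributes \<open>n!\<close> equal terms. Finally,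
  \<open>\<Prod>\<^sub>i \<phi>'(x\<^sub>i) = 2\<^sup>n \<Prod>\<^sub>i x\<^sub>i \<Prod>\<^sub>i\<^sub>\<noteq>\<^sub>j (x\<^sub>i - x\<^sub>j) (\<Prod>\<^sub>i\<^sub><\<^sub>j (x\<^sub>i + x\<^sub>j))\<^sup>2\<close> at \<open>x = \<lambda>\<^sub>I\<close>.\<close>

section \<open>Evaluation of multivariate polynomials\<close>

definition monom_eval :: "(nat \<Rightarrow> 'a::comm_ring_1) \<Rightarrow> (nat \<Rightarrow>\<^sub>0 nat) \<Rightarrow> 'a" where
  "monom_eval a m = (\<Prod>i\<in>Poly_Mapping.keys m. a i ^ Poly_Mapping.lookup m i)"

text \<open>Indices outside the support have exponent 0 and contribute a factor 1. Monomials with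
  different supports can thus be compared over one index set.\<close>

lemma monom_eval_superset:
  assumes "finite S" "Poly_Mapping.keys m \<subseteq> S"
  shows "monom_eval a m = (\<Prod>i\<in>S. a i ^ Poly_Mapping.lookup m i)"
  unfolding monom_eval_def
  by (rule prod.mono_neutral_left) (use assms in \<open>auto simp: in_keys_iff\<close>)

lemma monom_eval_0 [simp]: "monom_eval a 0 = 1"
  by (simp add: monom_eval_def)

lemma monom_eval_add: "monom_eval a (m + m') = monom_eval a m * monom_eval a m'"
proof -
  let ?S = "Poly_Mapping.keys m \<union> Poly_Mapping.keys m'"
  have "Poly_Mapping.keys (m + m') \<subseteq> ?S"
    by (rule Poly_Mapping.keys_add)
  then show ?thesis
    by (simp add: monom_eval_superset[of ?S] lookup_add power_add prod.distrib)
qed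

lemma mp_eval_monom_eval:
  "mp_eval a P = (\<Sum>m\<in>Poly_Mapping.keys P. Poly_Mapping.lookup P m * monom_eval a m)"
  by (simp add: mp_eval_def monom_eval_def)

lemma mp_eval_superset:
  assumes "finite S" "Poly_Mapping.keys P \<subseteq> S"
  shows "mp_eval a P = (\<Sum>m\<in>S. Poly_Mapping.lookup P m * monom_eval a m)"
  unfolding mp_eval_monom_eval
  by (rule sum.mono_neutral_left) (use assms in \<open>auto simp: in_keys_iff\<close>)

lemma mp_eval_0 [simp]: "mp_eval a 0 = 0"
  by (simp add: mp_eval_def)

lemma mp_eval_single [simp]: "mp_eval a (Poly_Mapping.single m c) = c * monom_eval a m"
  by (simp add: mp_eval_superset[of "{m}"])

lemma mp_eval_add: "mp_eval a (P + Q) = mp_eval a P + mp_eval a Q"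
proof -
  let ?S = "Poly_Mapping.keys P \<union> Poly_Mapping.keys Q"
  have "Poly_Mapping.keys (P + Q) \<subseteq> ?S"
    by (rule Poly_Mapping.keys_add)
  then show ?thesis
    by (simp add: mp_eval_superset[of ?S] lookup_add distrib_right sum.distrib)
qed

lemma mp_eval_uminus: "mp_eval a (- P) = - mp_eval a P"
  using mp_eval_add[of a P "- P"] by (simp add: eq_neg_iff_add_eq_0 add.commute)

lemma mp_eval_diff: "mp_eval a (P - Q) = mp_eval a P - mp_eval a Q"
  using mp_eval_add[of a P "- Q"] by (simp add: mp_eval_uminus)

lemma mp_eval_sum: "mp_eval a (sum f A) = (\<Sum>x\<in>A. mp_eval a (f x))"
  by (induction A rule: infinite_finite_induct) (simp_all add: mp_eval_add)

lemma mpoly_as_sum: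
  fixes P :: "'a::comm_ring_1 mpoly"
  shows "P = (\<Sum>m\<in>Poly_Mapping.keys P. Poly_Mapping.single m (Poly_Mapping.lookup P m))"
  by (rule poly_mapping_eqI) (auto simp: lookup_sum lookup_single when_def in_keys_iff)

lemma mp_eval_mult: "mp_eval a (P * Q) = mp_eval a P * mp_eval a Q"
proof -
  have "P * Q = (\<Sum>m\<in>Poly_Mapping.keys P. \<Sum>m'\<in>Poly_Mapping.keys Q.
      Poly_Mapping.single (m + m') (Poly_Mapping.lookup P m * Poly_Mapping.lookup Q m'))"
    by (subst mpoly_as_sum[of P], subst mpoly_as_sum[of Q]) (simp add: sum_product mult_single)
  then show ?thesis
    by (simp add: mp_eval_sum mp_eval_monom_eval[of a P] mp_eval_monom_eval[of a Q]
        sum_product monom_eval_add mult_ac)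
qed

lemma mp_eval_1 [simp]: "mp_eval a 1 = 1"
  using mp_eval_single[of a 0 1] by simp

lemma mp_eval_prod: "mp_eval a (prod f A) = (\<Prod>x\<in>A. mp_eval a (f x))"
  by (induction A rule: infinite_finite_induct) (simp_all add: mp_eval_mult)

lemma mp_eval_power: "mp_eval a (P ^ k) = mp_eval a P ^ k"
  by (induction k) (simp_all add: mp_eval_mult)

lemma mp_eval_var [simp]: "mp_eval a (mp_var i) = a i"
  by (simp add: mp_var_def monom_eval_def)

lemma mp_eval_const [simp]: "mp_eval a (mp_const c) = c"
  by (simp add: mp_const_def)

lemma mp_eval_subst: "mp_eval a (mp_subst q P) = mp_eval (\<lambda>i. mp_eval a (q i)) P"
  by (simp add: mp_subst_def mp_eval_sum mp_eval_mult mp_eval_prod mp_eval_power mp_eval_def[of _ P])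

text \<open>Allows passing from extensional grid points, which are \<open>undefined\<close> off
  \<open>{1..n}\<close>, to ordinary functions with the same values on
  \<open>{1..n}\<close>.\<close>

lemma mp_eval_cong:
  assumes "mp_vars P \<subseteq> S" "\<And>i. i \<in> S \<Longrightarrow> a i = b i"
  shows "mp_eval a P = mp_eval b P"
  unfolding mp_eval_def
  by (intro sum.cong prod.cong arg_cong2[where f = "(*)"] arg_cong2[where f = "(^)"] refl)
     (use assms in \<open>auto simp: mp_vars_def\<close>)

lemma mp_eval_permute:
  assumes "mp_symmetric n P" "\<pi> permutes {1..n}"
  shows "mp_eval (\<lambda>i. a (\<pi> i)) P = mp_eval a P"
proof -
  have "mp_subst (\<lambda>i. mp_var (\<pi> i)) P = P"
    using assms by (simp add: mp_symmetric_def)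
  then show ?thesis
    using mp_eval_subst[of a "\<lambda>i. mp_var (\<pi> i)" P] by simp
qed

section \<open>Polynomials of bounded degree\<close>

text \<open>A predicate rather than a computed maximum: the zero polynomial is no special case, and
  summing exponents over the fixed set \<open>S\<close> makes bounds add up under
  multiplication.\<close>

definition mp_bounded :: "nat set \<Rightarrow> nat \<Rightarrow> 'a::comm_ring_1 mpoly \<Rightarrow> bool" where
  "mp_bounded S d P \<longleftrightarrow> (\<forall>m\<in>Poly_Mapping.keys P.
     Poly_Mapping.keys m \<subseteq> S \<and> (\<Sum>i\<in>S. Poly_Mapping.lookup m i) \<le> d)"

lemma mp_bounded_mp_degree:
  assumes "finite S" "mp_vars P \<subseteq> S" "mp_degree P \<le> d"
  shows "mp_bounded S d P"
  unfolding mp_bounded_def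
proof (intro ballI conjI)
  fix m assume m: "m \<in> Poly_Mapping.keys P"
  then show sub: "Poly_Mapping.keys m \<subseteq> S"
    using assms by (auto simp: mp_vars_def)
  have "(\<Sum>i\<in>S. Poly_Mapping.lookup m i) = (\<Sum>i\<in>Poly_Mapping.keys m. Poly_Mapping.lookup m i)"
    by (rule sum.mono_neutral_right) (use sub assms in \<open>auto simp: in_keys_iff\<close>)
  also have "\<dots> \<le> mp_degree P"
    unfolding mp_degree_def by (rule Max_ge) (use m in auto)
  finally show "(\<Sum>i\<in>S. Poly_Mapping.lookup m i) \<le> d"
    using assms by simp
qed

lemma mp_bounded_1 [simp]: "mp_bounded S 0 1"
  by (simp add: mp_bounded_def)

lemma mp_bounded_mult:
  assumes "mp_bounded S d P" "mp_bounded S e Q"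
  shows "mp_bounded S (d + e) (P * Q)"
  unfolding mp_bounded_def
proof
  fix m assume "m \<in> Poly_Mapping.keys (P * Q)"
  then obtain u v where uv: "m = u + v" "u \<in> Poly_Mapping.keys P" "v \<in> Poly_Mapping.keys Q"
    using Poly_Mapping.keys_mult[of P Q] by blast
  then have "Poly_Mapping.keys u \<subseteq> S" "Poly_Mapping.keys v \<subseteq> S"
      "(\<Sum>i\<in>S. Poly_Mapping.lookup u i) \<le> d" "(\<Sum>i\<in>S. Poly_Mapping.lookup v i) \<le> e"
    using assms by (auto simp: mp_bounded_def)
  then show "Poly_Mapping.keys m \<subseteq> S \<and> (\<Sum>i\<in>S. Poly_Mapping.lookup m i) \<le> d + e"
    using Poly_Mapping.keys_add[of u v] uv(1) by (auto simp: lookup_add sum.distrib)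
qed

lemma mp_bounded_prod:
  assumes "\<And>x. x \<in> A \<Longrightarrow> mp_bounded S d (f x)"
  shows "mp_bounded S (card A * d) (prod f A)"
  using assms
  by (induction A rule: infinite_finite_induct) (simp_all add: mp_bounded_mult)

lemma mp_bounded_add:
  assumes "mp_bounded S d P" "mp_bounded S d Q"
  shows "mp_bounded S d (P + Q)"
  unfolding mp_bounded_def
proof
  fix m assume "m \<in> Poly_Mapping.keys (P + Q)"
  then have "m \<in> Poly_Mapping.keys P \<or> m \<in> Poly_Mapping.keys Q"
    using Poly_Mapping.keys_add[of P Q] by blast
  then show "Poly_Mapping.keys m \<subseteq> S \<and> (\<Sum>i\<in>S. Poly_Mapping.lookup m i) \<le> d"
    using assms unfolding mp_bounded_def by blast
qed

lemma mp_bounded_uminus: "mp_bounded S d P \<Longrightarrow> mp_bounded S d (- P)"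
  by (simp add: mp_bounded_def in_keys_iff)

lemma mp_bounded_diff:
  assumes "mp_bounded S d P" "mp_bounded S d Q"
  shows "mp_bounded S d (P - Q)"
  using mp_bounded_add[OF assms(1) mp_bounded_uminus[OF assms(2)]] by simp

lemma mp_bounded_var:
  assumes "finite S" "i \<in> S"
  shows "mp_bounded S 1 (mp_var i)"
  using assms by (simp add: mp_bounded_def mp_var_def lookup_single when_def)

section \<open>Coefficient extraction from values on a grid\<close>

text \<open>The left-hand side is the coefficient of degree \<open>d\<close> of the Lagrange interpolant of \<open>x ^ k\<close> on \<open>A\<close>.\<close>

lemma lagrange_power_sum:
  fixes A :: "'a::field set"
  assumes "finite A" "card A = Suc d" "k \<le> d"
  shows "(\<Sum>x\<in>A. x ^ k / (\<Prod>y\<in>A - {x}. x - y)) = (if k = d then 1 else 0)"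
proof -
  define L where "L x = (\<Prod>y\<in>A - {x}. [:- y, 1:])" for x :: 'a
  define w where "w x = (\<Prod>y\<in>A - {x}. x - y)" for x :: 'a
  define q where "q = (\<Sum>x\<in>A. smult (x ^ k / w x) (L x))"
  have w_nz: "w x \<noteq> 0" for x
    using assms(1) by (simp add: w_def)
  have deg_L: "degree (L x) = d" if "x \<in> A" for x
    unfolding L_def using that assms by (subst degree_prod_eq_sum_degree) auto
  have lead_L: "coeff (L x) d = 1" if "x \<in> A" for x
    using deg_L[OF that] lead_coeff_prod[of "\<lambda>y. [:- y, 1:]" "A - {x}"] by (simp add: L_def)
  have poly_L: "poly (L x) z = (if z = x then w x else 0)" if "x \<in> A" "z \<in> A" for x z
    using that assms(1) by (auto simp: L_def w_def poly_prod)
  have poly_q: "poly q z = z ^ k" if "z \<in> A" for z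
  proof -
    have "poly q z = (\<Sum>x\<in>A. if x = z then z ^ k else 0)"
      unfolding q_def poly_sum by (rule sum.cong) (use that w_nz in \<open>auto simp: poly_L\<close>)
    then show ?thesis
      using that assms(1) by simp
  qed
  have "degree q \<le> d"
    unfolding q_def by (rule degree_sum_le) (use assms deg_L in \<open>auto intro: order.trans[OF degree_smult_le]\<close>)
  \<comment> \<open>Both polynomials have degree at most \<open>d\<close> and agree on the
    \<open>d + 1\<close> points of \<open>A\<close>.\<close>
  then have "q = monom 1 k"
    by (intro poly_eqI_degree[of A]) (use assms poly_q in \<open>auto simp: poly_monom degree_monom_eq\<close>)
  moreover have "coeff q d = (\<Sum>x\<in>A. x ^ k / w x)"
    unfolding q_def coeff_sum by (rule sum.cong) (use lead_L in auto)
  ultimately show ?thesis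
    by (auto simp: w_def)
qed

text \<open>If every exponent is at least \<open>d\<close>, a total of at most
  \<open>card S * d\<close> forces equality throughout.\<close>

lemma monomial_full_or_deficient:
  assumes "finite S" "Poly_Mapping.keys m \<subseteq> S" "(\<Sum>i\<in>S. Poly_Mapping.lookup m i) \<le> card S * d"
  shows "m = (\<Sum>i\<in>S. Poly_Mapping.single i d) \<or> (\<exists>i\<in>S. Poly_Mapping.lookup m i < d)"
proof (rule disjCI)
  assume "\<not> (\<exists>i\<in>S. Poly_Mapping.lookup m i < d)"
  then have ge: "\<And>i. i \<in> S \<Longrightarrow> d \<le> Poly_Mapping.lookup m i"
    by force
  have eq: "Poly_Mapping.lookup m i = d" if "i \<in> S" for i
  proof (rule ccontr)
    assume "Poly_Mapping.lookup m i \<noteq> d"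
    then have "(\<Sum>i\<in>S. d) < (\<Sum>i\<in>S. Poly_Mapping.lookup m i)"
      using ge that assms(1) by (intro sum_strict_mono_ex1) (auto simp: le_less)
    then show False
      using assms(3) by simp
  qed
  show "m = (\<Sum>i\<in>S. Poly_Mapping.single i d)"
    by (rule poly_mapping_eqI)
       (use eq assms(1,2) in \<open>auto simp: lookup_sum lookup_single when_def in_keys_iff subset_iff\<close>)
qed

text \<open>Both sides are linear in \<open>F\<close>, so monomials suffice, and for a monomial the
  grid sum factors into the one-variable sums of \<open>lagrange_power_sum\<close>. The bound is on
  the total degree; single exponents may exceed \<open>d\<close>.\<close>

theorem lookup_eq_sum_grid:
  fixes A :: "'a::field set" and F :: "'a mpoly"
  assumes "finite S" "finite A" "card A = Suc d" "mp_bounded S (card S * d) F"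
  shows "Poly_Mapping.lookup F (\<Sum>i\<in>S. Poly_Mapping.single i d) =
    (\<Sum>a\<in>S \<rightarrow>\<^sub>E A. mp_eval a F / (\<Prod>i\<in>S. \<Prod>y\<in>A - {a i}. a i - y))"
proof -
  define w where "w x = (\<Prod>y\<in>A - {x}. x - y)" for x :: 'a
  let ?top = "\<Sum>i\<in>S. Poly_Mapping.single i d"
  have top: "Poly_Mapping.lookup ?top i = d" if "i \<in> S" for i
    using that assms(1) by (simp add: lookup_sum lookup_single when_def)
  have monom: "(\<Sum>a\<in>S \<rightarrow>\<^sub>E A. monom_eval a m / (\<Prod>i\<in>S. w (a i))) = (if m = ?top then 1 else 0)"
    if "m \<in> Poly_Mapping.keys F" for m
  proof -
    have m: "Poly_Mapping.keys m \<subseteq> S" "(\<Sum>i\<in>S. Poly_Mapping.lookup m i) \<le> card S * d"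
      using assms(4) that by (auto simp: mp_bounded_def)
    have "(\<Sum>a\<in>S \<rightarrow>\<^sub>E A. monom_eval a m / (\<Prod>i\<in>S. w (a i))) =
        (\<Sum>a\<in>S \<rightarrow>\<^sub>E A. \<Prod>i\<in>S. a i ^ Poly_Mapping.lookup m i / w (a i))"
      by (simp add: monom_eval_superset[OF assms(1) m(1)] prod_dividef)
    also have "\<dots> = (\<Prod>i\<in>S. \<Sum>x\<in>A. x ^ Poly_Mapping.lookup m i / w x)"
      by (rule prod_sum_PiE[symmetric]) (use assms in auto)
    also have "\<dots> = (if m = ?top then 1 else 0)"
    proof (cases "m = ?top")
      case True
      then show ?thesis
        using lagrange_power_sum[OF assms(2,3), of d] top by (simp add: w_def)
    next
      case False
      \<comment> \<open>The factor at \<open>i\<close> is zero, which settles the product even if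
        other exponents exceed \<open>d\<close>, where \<open>lagrange_power_sum\<close> does not
        apply.\<close>
      then obtain i where "i \<in> S" "Poly_Mapping.lookup m i < d"
        using monomial_full_or_deficient[OF assms(1) m] by blast
      then show ?thesis
        using False lagrange_power_sum[OF assms(2,3), of "Poly_Mapping.lookup m i"] assms(1)
        by (auto simp: w_def prod_zero_iff)
    qed
    finally show ?thesis .
  qed
  have "(\<Sum>a\<in>S \<rightarrow>\<^sub>E A. mp_eval a F / (\<Prod>i\<in>S. w (a i))) =
      (\<Sum>m\<in>Poly_Mapping.keys F. Poly_Mapping.lookup F m *
         (\<Sum>a\<in>S \<rightarrow>\<^sub>E A. monom_eval a m / (\<Prod>i\<in>S. w (a i))))"
    unfolding mp_eval_monom_eval sum_divide_distrib
    by (subst sum.swap) (simp add: sum_distrib_left)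
  also have "\<dots> = (\<Sum>m\<in>Poly_Mapping.keys F. if m = ?top then Poly_Mapping.lookup F m else 0)"
    by (rule sum.cong) (simp_all add: monom)
  also have "\<dots> = Poly_Mapping.lookup F ?top"
    by (simp add: in_keys_iff)
  finally show ?thesis
    by (simp add: w_def)
qed

section \<open>Products over pairs of indices\<close>

abbreviation offdiag :: "nat \<Rightarrow> (nat \<times> nat) set" where
  "offdiag n \<equiv> {(i, j). i \<in> {1..n} \<and> j \<in> {1..n} \<and> i \<noteq> j}"

abbreviation upper :: "nat \<Rightarrow> (nat \<times> nat) set" where
  "upper n \<equiv> {(i, j). 1 \<le> i \<and> i < j \<and> j \<le> n}"

lemma offdiag_Sigma: "offdiag n = Sigma {1..n} (\<lambda>i. {1..n} - {i})"
  by auto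

lemma finite_upper: "finite (upper n)"
  by (rule finite_subset[of _ "{1..n} \<times> {1..n}"]) auto

lemma offdiag_upper:
  "offdiag n = upper n \<union> prod.swap ` upper n" "upper n \<inter> prod.swap ` upper n = {}"
  by (auto simp: image_iff)

lemma card_offdiag: "card (offdiag n) = n * (n - 1)"
  unfolding offdiag_Sigma by simp

text \<open>Swapping coordinates maps \<open>upper n\<close> bijectively onto the rest of
  \<open>offdiag n\<close>. The factor 2 avoids division of natural numbers.\<close>

lemma card_upper: "2 * card (upper n) = n * (n - 1)"
proof -
  have "card (offdiag n) = card (upper n) + card (prod.swap ` upper n)"
    unfolding offdiag_upper(1) by (rule card_Un_disjoint) (use finite_upper offdiag_upper in auto)
  also have "card (prod.swap ` upper n) = card (upper n)"
    by (rule card_image) simp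
  finally show ?thesis
    unfolding card_offdiag by simp
qed

lemma prod_offdiag_permute:
  assumes "\<pi> permutes {1..n}"
  shows "(\<Prod>(i, j)\<in>offdiag n. f (\<pi> i) (\<pi> j)) = (\<Prod>(i, j)\<in>offdiag n. f i j)"
proof (rule prod.reindex_bij_witness[where j = "map_prod \<pi> \<pi>" and i = "map_prod (inv \<pi>) (inv \<pi>)"])
  fix p assume p: "p \<in> offdiag n"
  show "map_prod (inv \<pi>) (inv \<pi>) (map_prod \<pi> \<pi> p) = p" "map_prod \<pi> \<pi> (map_prod (inv \<pi>) (inv \<pi>) p) = p"
    using permutes_inverses[OF assms] by (simp_all add: map_prod_def case_prod_unfold)
  have maps: "map_prod \<rho> \<rho> p \<in> offdiag n" if \<rho>: "\<rho> permutes {1..n}" for \<rho>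
  proof -
    obtain i j where ij: "p = (i, j)" "i \<in> {1..n}" "j \<in> {1..n}" "i \<noteq> j"
      using p by blast
    then have "\<rho> i \<in> {1..n}" "\<rho> j \<in> {1..n}" "\<rho> i \<noteq> \<rho> j"
      using permutes_in_image[OF \<rho>] injD[OF permutes_inj[OF \<rho>], of i j] by blast+
    with ij(1) show ?thesis
      by simp
  qed
  show "map_prod \<pi> \<pi> p \<in> offdiag n" "map_prod (inv \<pi>) (inv \<pi>) p \<in> offdiag n"
    using maps[OF assms] maps[OF permutes_inv[OF assms]] .
qed (simp add: case_prod_unfold)

text \<open>Written over 2-element sets, the product over \<open>i < j\<close> is visibly symmetric.\<close>

lemma prod_upper_eq_pairs:
  fixes b :: "nat \<Rightarrow> 'a::comm_ring_1"
  shows "(\<Prod>(i, j)\<in>upper n. b i + b j) = (\<Prod>T | T \<subseteq> {1..n} \<and> card T = 2. \<Sum>i\<in>T. b i)"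
proof -
  let ?h = "\<lambda>(i::nat, j::nat). {i, j}"
  have "inj_on ?h (upper n)"
    by (auto simp: inj_on_def doubleton_eq_iff)
  moreover have "?h ` upper n = {T. T \<subseteq> {1..n} \<and> card T = 2}"
  proof (intro equalityI subsetI)
    fix T assume "T \<in> {T. T \<subseteq> {1..n} \<and> card T = 2}"
    then obtain x y where T: "T = {x, y}" "x \<noteq> y" "T \<subseteq> {1..n}"
      by (auto simp: card_2_iff)
    show "T \<in> ?h ` upper n"
    proof (cases "x < y")
      case True
      then show ?thesis using T by (intro image_eqI[of _ _ "(x, y)"]) auto
    next
      case False
      then show ?thesis using T by (intro image_eqI[of _ _ "(y, x)"]) auto
    qed
  qed auto
  ultimately have "bij_betw ?h (upper n) {T. T \<subseteq> {1..n} \<and> card T = 2}"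
    by (simp add: bij_betw_def)
  from prod.reindex_bij_betw[OF this, of "sum b", symmetric] show ?thesis
    by (auto intro!: prod.cong)
qed

text \<open>A permutation need not preserve \<open>i < j\<close>, but it permutes the 2-element
  subsets of \<open>{1..n}\<close>; hence the passage through
  \<open>prod_upper_eq_pairs\<close>.\<close>

lemma prod_upper_permute:
  fixes b :: "nat \<Rightarrow> 'a::comm_ring_1"
  assumes "\<pi> permutes {1..n}"
  shows "(\<Prod>(i, j)\<in>upper n. b (\<pi> i) + b (\<pi> j)) = (\<Prod>(i, j)\<in>upper n. b i + b j)"
  unfolding prod_upper_eq_pairs[of b] prod_upper_eq_pairs[of "\<lambda>i. b (\<pi> i)"]
proof (rule prod.reindex_bij_witness[where j = "\<lambda>T. \<pi> ` T" and i = "\<lambda>T. inv \<pi> ` T"])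
  note inj = permutes_inj[OF assms] permutes_inj[OF permutes_inv[OF assms]]
  fix T assume T: "T \<in> {T. T \<subseteq> {1..n} \<and> card T = 2}"
  show "inv \<pi> ` \<pi> ` T = T" "\<pi> ` inv \<pi> ` T = T"
    using permutes_inverses[OF assms] by (simp_all add: image_image)
  show "\<pi> ` T \<in> {T. T \<subseteq> {1..n} \<and> card T = 2}"
    using T permutes_in_image[OF assms] inj by (auto simp: card_image inj_on_subset)
  show "inv \<pi> ` T \<in> {T. T \<subseteq> {1..n} \<and> card T = 2}"
    using T permutes_in_image[OF permutes_inv[OF assms]] inj by (auto simp: card_image inj_on_subset)
  show "sum b (\<pi> ` T) = (\<Sum>i\<in>T. b (\<pi> i))"
    using inj by (simp add: sum.reindex inj_on_subset)
qed

text \<open>Each unordered pair occurs in both orders with the same sum, whence the square.\<close>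

lemma prod_offdiag_add:
  fixes b :: "nat \<Rightarrow> 'a::comm_ring_1"
  shows "(\<Prod>(i, j)\<in>offdiag n. b i + b j) = (\<Prod>(i, j)\<in>upper n. b i + b j)\<^sup>2"
proof -
  have "(\<Prod>(i, j)\<in>offdiag n. b i + b j) =
      (\<Prod>(i, j)\<in>upper n. b i + b j) * (\<Prod>(i, j)\<in>prod.swap ` upper n. b i + b j)"
    unfolding offdiag_upper(1) by (rule prod.union_disjoint) (use finite_upper offdiag_upper in auto)
  also have "(\<Prod>(i, j)\<in>prod.swap ` upper n. b i + b j) = (\<Prod>(i, j)\<in>upper n. b i + b j)"
    by (subst prod.reindex) (auto simp: add.commute intro!: prod.cong)
  finally show ?thesis
    by (simp add: power2_eq_square)
qed

section \<open>Lagrange weights of a set of the form \<open>{\<plusminus>b\<^sub>i}\<close>\<close>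

definition plus_minus :: "(nat \<Rightarrow> 'a::comm_ring_1) \<Rightarrow> nat set \<Rightarrow> 'a set" where
  "plus_minus b S = b ` S \<union> (\<lambda>i. - b i) ` S"

lemma finite_plus_minus [simp]: "finite S \<Longrightarrow> finite (plus_minus b S)"
  by (simp add: plus_minus_def)

text \<open>A change of sign fixes each pair \<open>{l i, - l i}\<close>, so all sign patterns share
  one grid and the weights can be computed with \<open>b = signed l I\<close>.\<close>

lemma plus_minus_signed: "plus_minus (signed l I) S = plus_minus l S"
proof -
  have "{signed l I i, - signed l I i} = {l i, - l i}" for i
    by (auto simp: signed_def)
  moreover have "plus_minus b S = (\<Union>i\<in>S. {b i, - b i})" for b :: "nat \<Rightarrow> 'a"
    by (auto simp: plus_minus_def)
  ultimately show ?thesis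
    by simp
qed

text \<open>The assumptions depend on \<open>b\<close> only up to sign, so they pass from
  \<open>l\<close> to every \<open>signed l I\<close>.\<close>

locale distinct_squares =
  fixes b :: "nat \<Rightarrow> 'a::field_char_0" and S :: "nat set"
  assumes finite_S: "finite S"
    and nonzero: "\<And>i. i \<in> S \<Longrightarrow> b i \<noteq> 0"
    and squares_neq: "\<And>i j. i \<in> S \<Longrightarrow> j \<in> S \<Longrightarrow> i \<noteq> j \<Longrightarrow> (b i)\<^sup>2 \<noteq> (b j)\<^sup>2"
begin

lemma eq_iff: "i \<in> S \<Longrightarrow> j \<in> S \<Longrightarrow> b i = b j \<longleftrightarrow> i = j"
  using squares_neq by metis

lemma neq_minus: "i \<in> S \<Longrightarrow> j \<in> S \<Longrightarrow> b i \<noteq> - b j"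
  using squares_neq[of i j] nonzero[of i] by (cases "i = j") auto

lemma minus_neq: "i \<in> S \<Longrightarrow> j \<in> S \<Longrightarrow> - b i \<noteq> b j"
  using neq_minus[of j i] by metis

lemma card_plus_minus: "card (plus_minus b S) = 2 * card S"
  unfolding plus_minus_def
  by (subst card_Un_disjoint)
     (use finite_S eq_iff neq_minus in \<open>auto simp: card_image inj_on_def\<close>)

text \<open>This is the derivative at \<open>b i\<close> of the product of all
  \<open>x^2 - (b j)^2\<close>: the node \<open>- b i\<close> contributes \<open>2 * b i\<close>,
  and the nodes \<open>b j\<close> and \<open>- b j\<close> with \<open>j \<noteq> i\<close>
  contribute the other factors.\<close>

lemma prod_plus_minus_diff:
  assumes "i \<in> S"
  shows "(\<Prod>y\<in>plus_minus b S - {b i}. b i - y) =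
    2 * b i * (\<Prod>j\<in>S - {i}. (b i - b j) * (b i + b j))"
proof -
  have A: "plus_minus b S - {b i} = b ` (S - {i}) \<union> (\<lambda>j. - b j) ` S"
    using assms eq_iff minus_neq neq_minus by (fastforce simp: plus_minus_def)
  have "(\<Prod>y\<in>plus_minus b S - {b i}. b i - y) =
      (\<Prod>y\<in>b ` (S - {i}). b i - y) * (\<Prod>y\<in>(\<lambda>j. - b j) ` S. b i - y)"
    unfolding A by (rule prod.union_disjoint) (use finite_S neq_minus in auto)
  also have "(\<Prod>y\<in>b ` (S - {i}). b i - y) = (\<Prod>j\<in>S - {i}. b i - b j)"
    by (subst prod.reindex) (use eq_iff in \<open>auto simp: inj_on_def\<close>)
  also have "(\<Prod>y\<in>(\<lambda>j. - b j) ` S. b i - y) = (\<Prod>j\<in>S. b i + b j)"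
    by (subst prod.reindex) (use eq_iff in \<open>auto simp: inj_on_def\<close>)
  also have "\<dots> = 2 * b i * (\<Prod>j\<in>S - {i}. b i + b j)"
    using finite_S assms by (simp add: prod.remove[of S i])
  finally show ?thesis
    by (simp add: prod.distrib mult_ac)
qed

end

text \<open>The factors \<open>b i + b j\<close> run over ordered pairs, so
  \<open>prod_offdiag_add\<close> turns them into a square; one copy later cancels against the
  numerator.\<close>

lemma prod_weights:
  assumes "distinct_squares b {1..n}"
  shows "(\<Prod>i\<in>{1..n}. \<Prod>y\<in>plus_minus b {1..n} - {b i}. b i - y) =
    2 ^ n * (\<Prod>i\<in>{1..n}. b i) * (\<Prod>(i, j)\<in>offdiag n. b i - b j) *
    (\<Prod>(i, j)\<in>upper n. b i + b j)\<^sup>2"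
proof -
  have "(\<Prod>i\<in>{1..n}. \<Prod>y\<in>plus_minus b {1..n} - {b i}. b i - y) =
      (\<Prod>i\<in>{1..n}. 2 * b i * (\<Prod>j\<in>{1..n} - {i}. (b i - b j) * (b i + b j)))"
    by (rule prod.cong[OF refl], rule distinct_squares.prod_plus_minus_diff[OF assms])
  also have "\<dots> = 2 ^ n * (\<Prod>i\<in>{1..n}. b i) *
      (\<Prod>(i, j)\<in>offdiag n. (b i - b j) * (b i + b j))"
    unfolding offdiag_Sigma by (subst prod.Sigma[symmetric]) (auto simp: prod.distrib)
  also have "(\<Prod>(i, j)\<in>offdiag n. (b i - b j) * (b i + b j)) =
      (\<Prod>(i, j)\<in>offdiag n. b i - b j) * (\<Prod>(i, j)\<in>offdiag n. b i + b j)"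
    by (simp add: prod.distrib case_prod_unfold)
  finally show ?thesis
    unfolding prod_offdiag_add by (simp only: mult_ac)
qed

section \<open>The nonvanishing grid points\<close>

text \<open>Squares forget signs and are distinct, so they determine \<open>\<pi>\<close>; the signs
  then determine \<open>I\<close>, as \<open>l i\<close> and \<open>- l i\<close> differ. This
  permits reindexing a sum over grid points by pairs \<open>(I, \<pi>)\<close>.\<close>

lemma signed_permute_inj:
  assumes "distinct_squares l {1..n}"
  shows "inj_on (\<lambda>(I, \<pi>). \<lambda>i\<in>{1..n}. signed l I (\<pi> i)) (Pow {1..n} \<times> {\<pi>. \<pi> permutes {1..n}})"
proof (rule inj_onI, clarify)
  interpret distinct_squares l "{1..n}" by (rule assms)
  fix I \<pi> J \<rho>
  assume IJ: "I \<subseteq> {1..n}" "J \<subseteq> {1..n}"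
    and perm: "\<pi> permutes {1..n}" "\<rho> permutes {1..n}"
    and eq: "(\<lambda>i\<in>{1..n}. signed l I (\<pi> i)) = (\<lambda>i\<in>{1..n}. signed l J (\<rho> i))"
  have eq': "signed l I (\<pi> i) = signed l J (\<rho> i)" if "i \<in> {1..n}" for i
    using fun_cong[OF eq, of i] that by simp
  have "\<pi> i = \<rho> i" for i
  proof (cases "i \<in> {1..n}")
    case True
    have "(l (\<pi> i))\<^sup>2 = (signed l I (\<pi> i))\<^sup>2" "(l (\<rho> i))\<^sup>2 = (signed l J (\<rho> i))\<^sup>2"
      by (simp_all add: signed_def)
    then have "(l (\<pi> i))\<^sup>2 = (l (\<rho> i))\<^sup>2"
      using eq'[OF True] by simp
    then show ?thesis
      using squares_neq True perm by (metis permutes_in_image)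
  next
    case False
    then show ?thesis
      using perm by (simp add: permutes_not_in)
  qed
  then have pr: "\<pi> = \<rho>"
    by (rule ext)
  have "i \<in> I \<longleftrightarrow> i \<in> J" for i
  proof (cases "i \<in> {1..n}")
    case True
    then obtain k where k: "k \<in> {1..n}" "\<pi> k = i"
      using permutes_image[OF perm(1)] by (metis imageE)
    then have "signed l I i = signed l J i"
      using eq'[of k] pr by simp
    moreover have "l i \<noteq> - l i" "- l i \<noteq> l i"
      using neq_minus[OF True True] minus_neq[OF True True] .
    ultimately show ?thesis
      by (simp add: signed_def split: if_splits)
  qed (use IJ in auto)
  with pr show "I = J \<and> \<pi> = \<rho>"
    by auto
qed

text \<open>Each coordinate is \<open>l k\<close> or \<open>- l k\<close> for some \<open>k\<close>,
  and two coordinates sharing \<open>k\<close> would be equal or opposite. So the choice of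
  \<open>k\<close> is injective on a finite set, hence a permutation, and the signs give
  \<open>I\<close>.\<close>

lemma grid_point_signed_permute:
  assumes a: "a \<in> {1..n} \<rightarrow>\<^sub>E plus_minus l {1..n}"
    and distinct: "\<And>i j. i \<in> {1..n} \<Longrightarrow> j \<in> {1..n} \<Longrightarrow> i \<noteq> j \<Longrightarrow> a i \<noteq> a j \<and> a i + a j \<noteq> 0"
  shows "a \<in> (\<lambda>(I, \<pi>). \<lambda>i\<in>{1..n}. signed l I (\<pi> i)) ` (Pow {1..n} \<times> {\<pi>. \<pi> permutes {1..n}})"
proof -
  have "\<exists>k\<in>{1..n}. a i = l k \<or> a i = - l k" if "i \<in> {1..n}" for i
    using PiE_mem[OF a that] by (auto simp: plus_minus_def)
  then obtain s where s: "\<And>i. i \<in> {1..n} \<Longrightarrow> s i \<in> {1..n}"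
      "\<And>i. i \<in> {1..n} \<Longrightarrow> a i = l (s i) \<or> a i = - l (s i)"
    by metis
  \<comment> \<open>\<open>permutes\<close> demands the identity off \<open>{1..n}\<close>.\<close>
  define \<pi> where "\<pi> i = (if i \<in> {1..n} then s i else i)" for i
  have "inj_on \<pi> {1..n}"
  proof (rule inj_onI, rule ccontr)
    fix i j assume ij: "i \<in> {1..n}" "j \<in> {1..n}" "\<pi> i = \<pi> j" "i \<noteq> j"
    then have "s i = s j"
      by (simp add: \<pi>_def)
    then have "a i = a j \<or> a i + a j = 0"
      using s(2)[OF ij(1)] s(2)[OF ij(2)] by auto
    then show False
      using distinct ij by blast
  qed
  moreover have "\<pi> ` {1..n} \<subseteq> {1..n}"
    using s(1) by (auto simp: \<pi>_def)
  ultimately have "bij_betw \<pi> {1..n} {1..n}"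
    by (simp add: bij_betw_def endo_inj_surj)
  then have perm: "\<pi> permutes {1..n}"
    by (rule bij_imp_permutes) (auto simp: \<pi>_def)
  \<comment> \<open>The value \<open>l k\<close> or \<open>- l k\<close> sits at position
    \<open>inv \<pi> k\<close>; its sign decides whether \<open>k\<close> belongs to
    \<open>I\<close>.\<close>
  define I where "I = {k \<in> {1..n}. a (inv \<pi> k) = l k}"
  have "a i = signed l I (\<pi> i)" if "i \<in> {1..n}" for i
    using s[OF that] that permutes_inverses(2)[OF perm, of i]
    by (auto simp: signed_def I_def \<pi>_def)
  then have "a = (\<lambda>i\<in>{1..n}. signed l I (\<pi> i))"
    using PiE_restrict[OF a] by (metis (mono_tags, lifting) restrict_ext)
  then show ?thesis
    using perm by (intro image_eqI[of _ _ "(I, \<pi>)"]) (auto simp: I_def)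
qed

section \<open>From the grid formula to the sum over sign patterns\<close>

theorem theorem1:
  fixes n :: nat and l :: "nat \<Rightarrow> 'a::field_char_0" and P :: "'a mpoly"
  assumes "n \<ge> 1"
    and "\<And>i. i \<in> {1..n} \<Longrightarrow> l i \<noteq> 0"
    and "\<And>i j. i \<in> {1..n} \<Longrightarrow> j \<in> {1..n} \<Longrightarrow> i \<noteq> j \<Longrightarrow> (l i)\<^sup>2 \<noteq> (l j)\<^sup>2"
    and "mp_vars P \<subseteq> {1..n}"
    and "mp_symmetric n P"
    and "mp_degree P \<le> n * (n + 1) div 2"
  shows "(\<Sum>I\<in>Pow {1..n}. mp_eval (signed l I) P /
            ((\<Prod>(i, j)\<in>{(i, j). 1 \<le> i \<and> i < j \<and> j \<le> n}. signed l I i + signed l I j) *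
             (\<Prod>i\<in>{1..n}. signed l I i))) =
         2 ^ n * Poly_Mapping.lookup
           (P * (\<Prod>(i, j)\<in>{(i, j). i \<in> {1..n} \<and> j \<in> {1..n} \<and> i \<noteq> j}. mp_var i - mp_var j) *
                (\<Prod>(i, j)\<in>{(i, j). 1 \<le> i \<and> i < j \<and> j \<le> n}. mp_var i + mp_var j))
           (\<Sum>i\<in>{1..n}. Poly_Mapping.single i (2 * n - 1)) / fact n"
proof -
  let ?S = "{1..n}"
  let ?A = "plus_minus l ?S"
  let ?perms = "{\<pi>. \<pi> permutes ?S}"
  let ?g = "\<lambda>(I, \<pi>). \<lambda>i\<in>?S. signed l I (\<pi> i)"
  define D where "D a = (\<Prod>(i, j)\<in>offdiag n. a i - a j)" for a :: "nat \<Rightarrow> 'a"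
  define E where "E a = (\<Prod>(i, j)\<in>upper n. a i + a j)" for a :: "nat \<Rightarrow> 'a"
  define W where "W a = (\<Prod>i\<in>?S. \<Prod>y\<in>?A - {a i}. a i - y)" for a :: "nat \<Rightarrow> 'a"
  define F where "F = P * (\<Prod>(i, j)\<in>offdiag n. mp_var i - mp_var j) *
    (\<Prod>(i, j)\<in>upper n. mp_var i + mp_var j)"
  define c where "c = Poly_Mapping.lookup F (\<Sum>i\<in>?S. Poly_Mapping.single i (2 * n - 1))"
  have ds: "distinct_squares (signed l I) ?S" for I
    using assms(2,3) by unfold_locales (auto simp: signed_def)
  have ds_l: "distinct_squares l ?S"
    using assms(2,3) by unfold_locales auto
  have finite_offdiag: "finite (offdiag n)"
    unfolding offdiag_Sigma by simp
  have eval_F: "mp_eval a F = mp_eval a P * D a * E a" for a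
    by (simp add: F_def D_def E_def mp_eval_mult mp_eval_prod mp_eval_diff mp_eval_add case_prod_unfold)

  have bounded_F: "mp_bounded ?S (card ?S * (2 * n - 1)) F"
  proof -
    have "mp_bounded ?S (n * (n + 1) div 2 + card (offdiag n) * 1 + card (upper n) * 1) F"
      unfolding F_def
      by (intro mp_bounded_mult mp_bounded_prod mp_bounded_mp_degree[OF _ assms(4,6)])
         (auto intro!: mp_bounded_diff mp_bounded_add mp_bounded_var[unfolded One_nat_def])
    \<comment> \<open>With the cardinalities inserted, n(n+1)/2 + n(n-1) + n(n-1)/2 = n(2n-1).
      Doubling clears the divisions, and \<open>n = Suc m\<close> resolves the truncated
      subtractions.\<close>
    moreover have "n * (n + 1) div 2 + card (offdiag n) * 1 + card (upper n) * 1 = card ?S * (2 * n - 1)"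
    proof -
      obtain m where m: "n = Suc m"
        using assms(1) by (cases n) auto
      have "2 * (n * (n + 1) div 2) = n * (n + 1)"
        by simp
      then have "2 * (n * (n + 1) div 2 + card (offdiag n) + card (upper n)) = 2 * (n * (2 * n - 1))"
        unfolding distrib_left card_upper card_offdiag by (simp add: m algebra_simps)
      then show ?thesis
        by simp
    qed
    ultimately show ?thesis
      by simp
  qed
  \<comment> \<open>The set \<open>?A\<close> has \<open>2 * n\<close> elements, which is
    \<open>Suc (2 * n - 1)\<close> because \<open>n \<ge> 1\<close>.\<close>
  have c_grid: "c = (\<Sum>a\<in>?S \<rightarrow>\<^sub>E ?A. mp_eval a F / W a)"
    unfolding c_def W_def
    by (rule lookup_eq_sum_grid[OF _ _ _ bounded_F])
       (use assms(1) distinct_squares.card_plus_minus[OF ds_l] in auto)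
  have vanish: "mp_eval a F / W a = 0" if "a \<in> (?S \<rightarrow>\<^sub>E ?A) - ?g ` (Pow ?S \<times> ?perms)" for a
  proof (rule ccontr)
    assume "mp_eval a F / W a \<noteq> 0"
    \<comment> \<open>The square of \<open>E a\<close> is a product over all ordered pairs, so
      opposite coordinates are excluded in either order.\<close>
    then have "D a \<noteq> 0" "(E a)\<^sup>2 \<noteq> 0"
      by (auto simp: eval_F)
    then have "a i \<noteq> a j \<and> a i + a j \<noteq> 0" if "i \<in> ?S" "j \<in> ?S" "i \<noteq> j" for i j
      using that finite_offdiag unfolding D_def E_def prod_offdiag_add[symmetric]
      by (auto simp: prod_zero_iff)
    then have "a \<in> ?g ` (Pow ?S \<times> ?perms)"
      using that by (intro grid_point_signed_permute) auto
    then show False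
      using that by blast
  qed
  have image: "?g ` (Pow ?S \<times> ?perms) \<subseteq> ?S \<rightarrow>\<^sub>E ?A"
  proof clarify
    fix I \<pi> assume "\<pi> permutes ?S"
    then have "signed l I (\<pi> i) \<in> ?A" if "i \<in> ?S" for i
      using permutes_in_image[of \<pi> ?S i] that by (auto simp: plus_minus_def signed_def)
    then show "(\<lambda>i\<in>?S. signed l I (\<pi> i)) \<in> ?S \<rightarrow>\<^sub>E ?A"
      by auto
  qed
  \<comment> \<open>Permuting coordinates only permutes the factors of \<open>D\<close>,
    \<open>E\<close> and \<open>W\<close>, and \<open>P\<close> is symmetric; the restriction is
    harmless since only coordinates in \<open>{1..n}\<close> are read.\<close>
  have invariant: "mp_eval (?g (I, \<pi>)) F / W (?g (I, \<pi>)) = mp_eval (signed l I) F / W (signed l I)"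
    if "\<pi> permutes ?S" for I \<pi>
  proof -
    let ?b = "signed l I"
    have "mp_eval (?g (I, \<pi>)) P = mp_eval (\<lambda>i. ?b (\<pi> i)) P"
      by (rule mp_eval_cong[OF assms(4)]) simp
    also have "\<dots> = mp_eval ?b P"
      by (rule mp_eval_permute[OF assms(5) that])
    finally have "mp_eval (?g (I, \<pi>)) P = mp_eval ?b P" .
    moreover have "D (?g (I, \<pi>)) = (\<Prod>(i, j)\<in>offdiag n. ?b (\<pi> i) - ?b (\<pi> j))"
      unfolding D_def by (rule prod.cong) auto
    then have "D (?g (I, \<pi>)) = D ?b"
      unfolding D_def using prod_offdiag_permute[OF that, of "\<lambda>i j. ?b i - ?b j"] by simp
    moreover have "E (?g (I, \<pi>)) = (\<Prod>(i, j)\<in>upper n. ?b (\<pi> i) + ?b (\<pi> j))"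
      unfolding E_def by (rule prod.cong) auto
    then have "E (?g (I, \<pi>)) = E ?b"
      unfolding E_def using prod_upper_permute[OF that, of ?b] by simp
    moreover have "W (?g (I, \<pi>)) = (\<Prod>i\<in>?S. \<Prod>y\<in>?A - {?b (\<pi> i)}. ?b (\<pi> i) - y)"
      unfolding W_def by (rule prod.cong) auto
    then have "W (?g (I, \<pi>)) = W ?b"
      unfolding W_def using prod.permute[OF that, of "\<lambda>i. \<Prod>y\<in>?A - {?b i}. ?b i - y"]
      by (simp add: o_def)
    ultimately show ?thesis
      by (simp only: eval_F)
  qed
  have "c = (\<Sum>a\<in>?g ` (Pow ?S \<times> ?perms). mp_eval a F / W a)"
    unfolding c_grid by (rule sum.mono_neutral_right[OF _ image]) (use vanish in \<open>auto intro!: finite_PiE\<close>)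
  also have "\<dots> = (\<Sum>(I, \<pi>)\<in>Pow ?S \<times> ?perms. mp_eval (?g (I, \<pi>)) F / W (?g (I, \<pi>)))"
    by (subst sum.reindex[OF signed_permute_inj[OF ds_l]]) (simp add: case_prod_unfold)
  also have "\<dots> = (\<Sum>(I, \<pi>)\<in>Pow ?S \<times> ?perms. mp_eval (signed l I) F / W (signed l I))"
    by (rule sum.cong) (use invariant in auto)
  \<comment> \<open>The summand no longer depends on \<open>\<pi>\<close>, and there are
    \<open>fact n\<close> permutations.\<close>
  also have "\<dots> = fact n * (\<Sum>I\<in>Pow ?S. mp_eval (signed l I) F / W (signed l I))"
    by (simp add: sum.cartesian_product[symmetric] card_permutations sum_distrib_left)
  finally have c_sum: "c = fact n * (\<Sum>I\<in>Pow ?S. mp_eval (signed l I) F / W (signed l I))" .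
  have summand: "2 ^ n * (mp_eval (signed l I) F / W (signed l I)) =
      mp_eval (signed l I) P / (E (signed l I) * (\<Prod>i\<in>?S. signed l I i))" for I
  proof -
    let ?b = "signed l I"
    interpret distinct_squares ?b ?S by (rule ds)
    have W: "W ?b = 2 ^ n * (\<Prod>i\<in>?S. ?b i) * D ?b * (E ?b)\<^sup>2"
      using prod_weights[OF ds, of I] by (simp add: W_def D_def E_def plus_minus_signed)
    \<comment> \<open>No weight vanishes, since each point is removed from its own product; the
      factored form then shows that everything to be cancelled is nonzero.\<close>
    have "W ?b \<noteq> 0"
      by (auto simp: W_def)
    then have "(\<Prod>i\<in>?S. ?b i) \<noteq> 0" "D ?b \<noteq> 0" "E ?b \<noteq> 0"
      unfolding W by (metis mult_zero_left mult_zero_right power_zero_numeral)+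
    moreover have "2 ^ n * (p * d * e / (2 ^ n * r * d * e\<^sup>2)) = p / (e * r)"
      if "r \<noteq> 0" "d \<noteq> 0" "e \<noteq> 0" for p d e r :: 'a
      using that by (simp add: field_simps power2_eq_square)
    ultimately show ?thesis
      unfolding eval_F W by blast
  qed
  have "(\<Sum>I\<in>Pow ?S. mp_eval (signed l I) P / (E (signed l I) * (\<Prod>i\<in>?S. signed l I i))) =
      2 ^ n * c / fact n"
    unfolding summand[symmetric] c_sum sum_distrib_left[symmetric] by simp
  then show ?thesis
    unfolding E_def c_def F_def .
qed

end
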